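(* Let $c\ge 2$ and $h\ge 0$ be fixed natural numbers and let $T_{c,h}$ be the perfect $c$-ary tree of height $h$ with positive real edge weights. Then $f(T_{c,h};n)\approx n^{c^h}$.
   Context: A perfect $c$-ary tree of height $h$ is a rooted tree in which every non-leaf vertex has exactly $c$ children and all $c^h$ leaves are at distance exactly $h$ (number of edges) from the root. For an edge-weighted graph $G$ on $m$ vertices, an $m$-tuple of points $X$ in $\mathbb R^2$ is a distance $G$-configuration if there is a bijection $\varphi:V(G)\to X$ with $|\varphi(u)-\varphi(v)|=w(\{u,v\})$ for every edge $\{u,v\}$, where $w$ is the weight function. $f(G;n)$ is the maximum over all sets of $n$ points in $\mathbb R^2$ of the number of distance $G$-configurations in the set. $X(n)\approx Y(n)$ means $X(n)\le CY(n)$ and $Y(n)\le CX(n)$ for all $n>N$, with $C,N$ independent of $n$ ($c,h$ regarded as fixed). *)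

theory Defs
  imports "HOL-Analysis.Analysis"
begin

section \<open>Rooted trees\<close>

definition simple_graph :: "'v set \<Rightarrow> 'v set set \<Rightarrow> bool" where
  "simple_graph V E \<longleftrightarrow> finite V \<and> E \<subseteq> {{u, v} | u v. u \<in> V \<and> v \<in> V \<and> u \<noteq> v}"

definition adj :: "'v set set \<Rightarrow> ('v \<times> 'v) set" where
  "adj E = {(u, v). {u, v} \<in> E}"

definition graph_connected :: "'v set \<Rightarrow> 'v set set \<Rightarrow> bool" where
  "graph_connected V E \<longleftrightarrow> V \<noteq> {} \<and> (\<forall>u\<in>V. \<forall>v\<in>V. (u, v) \<in> (adj E)\<^sup>*)"

definition graph_cycle :: "'v set set \<Rightarrow> 'v list \<Rightarrow> bool" where
  "graph_cycle E xs \<longleftrightarrow> 3 \<le> length xs \<and> distinct xs \<and>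
     (\<forall>i<length xs. {xs ! i, xs ! (Suc i mod length xs)} \<in> E)"

definition is_tree :: "'v set \<Rightarrow> 'v set set \<Rightarrow> bool" where
  "is_tree V E \<longleftrightarrow> simple_graph V E \<and> graph_connected V E \<and> (\<nexists>xs. graph_cycle E xs)"

text \<open>The number of edges of a shortest walk; a junk value if there is no walk.\<close>

definition graph_dist :: "'v set set \<Rightarrow> 'v \<Rightarrow> 'v \<Rightarrow> nat" where
  "graph_dist E u v = (LEAST k. (u, v) \<in> adj E ^^ k)"

definition children :: "'v set set \<Rightarrow> 'v \<Rightarrow> 'v \<Rightarrow> 'v set" where
  "children E r u = {v. {u, v} \<in> E \<and> graph_dist E r v = Suc (graph_dist E r u)}"

text \<open>Leaves are the vertices without children, so the root is a leaf of the one-vertex tree.\<close>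

definition leaves :: "'v set \<Rightarrow> 'v set set \<Rightarrow> 'v \<Rightarrow> 'v set" where
  "leaves V E r = {v \<in> V. children E r v = {}}"

definition perfect_tree :: "nat \<Rightarrow> nat \<Rightarrow> 'v set \<Rightarrow> 'v set set \<Rightarrow> 'v \<Rightarrow> bool" where
  "perfect_tree c h V E r \<longleftrightarrow>
     is_tree V E \<and> r \<in> V \<and>
     (\<forall>v \<in> V - leaves V E r. card (children E r v) = c) \<and>
     card (leaves V E r) = c ^ h \<and>
     (\<forall>v \<in> leaves V E r. graph_dist E r v = h)"

section \<open>Distance configurations\<close>

text \<open>Tuples are lists. As the length of the list is the number of vertices, the bijection onto its
  set of entries forces the entries to be distinct. The order of the entries is not tied to
  the vertices.\<close>

definition distance_configuration ::
    "'v set \<Rightarrow> 'v set set \<Rightarrow> ('v set \<Rightarrow> real) \<Rightarrow> (real ^ 2) list \<Rightarrow> bool" where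
  "distance_configuration V E w X \<longleftrightarrow>
     length X = card V \<and>
     (\<exists>\<phi>. bij_betw \<phi> V (set X) \<and>
          (\<forall>u v. {u, v} \<in> E \<longrightarrow> dist (\<phi> u) (\<phi> v) = w {u, v}))"

definition configurations_in ::
    "'v set \<Rightarrow> 'v set set \<Rightarrow> ('v set \<Rightarrow> real) \<Rightarrow> (real ^ 2) set \<Rightarrow> (real ^ 2) list set" where
  "configurations_in V E w P = {X. set X \<subseteq> P \<and> distance_configuration V E w X}"

definition max_configurations ::
    "'v set \<Rightarrow> 'v set set \<Rightarrow> ('v set \<Rightarrow> real) \<Rightarrow> nat \<Rightarrow> nat" where
  "max_configurations V E w n =
     Max {card (configurations_in V E w P) | P. finite P \<and> card P = n}"

lemma finite_configurations_in:
  assumes "finite P"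
  shows "finite (configurations_in V E w P)"
    and "card (configurations_in V E w P) \<le> card P ^ card V"
proof -
  have sub: "configurations_in V E w P \<subseteq> {X. set X \<subseteq> P \<and> length X = card V}"
    by (auto simp: configurations_in_def distance_configuration_def)
  have fin: "finite {X. set X \<subseteq> P \<and> length X = card V}"
    using assms by (rule finite_lists_length_eq)
  show "finite (configurations_in V E w P)"
    using sub fin by (rule finite_subset)
  show "card (configurations_in V E w P) \<le> card P ^ card V"
    using card_mono[OF fin sub] card_lists_length_eq[OF assms] by simp
qed

text \<open>The maximum above is taken over a finite nonempty set, hence attained.\<close>

lemma max_configurations_range:
  "finite {card (configurations_in V E w P) | P. finite P \<and> card P = n}"
  "{card (configurations_in V E w P) | P. finite P \<and> card P = n} \<noteq> {}"
proof -
  have "{card (configurations_in V E w P) | P. finite P \<and> card P = n} \<subseteq> {..n ^ card V}"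
    using finite_configurations_in(2) by auto
  then show "finite {card (configurations_in V E w P) | P. finite P \<and> card P = n}"
    by (rule finite_subset) simp
  have "infinite (UNIV :: (real ^ 2) set)"
    using not_bounded_UNIV finite_imp_bounded by blast
  then obtain P :: "(real ^ 2) set" where "finite P" "card P = n"
    using infinite_arbitrarily_large by blast
  then show "{card (configurations_in V E w P) | P. finite P \<and> card P = n} \<noteq> {}"
    by blast
qed

section \<open>Comparison up to constants\<close>

definition same_order :: "(nat \<Rightarrow> real) \<Rightarrow> (nat \<Rightarrow> real) \<Rightarrow> bool" where
  "same_order X Y \<longleftrightarrow> (\<exists>C>0. \<exists>N. \<forall>n>N. X n \<le> C * Y n \<and> Y n \<le> C * X n)"

end

(*
  Once the leaves are placed, every inner vertex lies on two circles around distinct points, the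
  images of two of its children, so working upwards from the leaves there are at most two choices
  for each inner vertex. This gives the upper bound O(n^(c^h)). Conversely, fix an injective
  placement of the tree; the leaves can then move independently on circles around their parents,
  and putting about n / c^h points on each of these circles yields the lower bound.
*)
theory Submission
  imports Defs
begin

section \<open>Circles in the plane\<close>

text \<open>A finite connected set has at most one point, whereas a circle of positive radius is
  connected and contains two antipodal points.\<close>

lemma infinite_sphere_plane:
  fixes a :: "real ^ 2"
  assumes "\<rho> > 0"
  shows "infinite (sphere a \<rho>)"
proof
  assume fin: "finite (sphere a \<rho>)"
  have "connected (sphere a \<rho>)"
    by (rule connected_sphere) simp
  with fin consider "sphere a \<rho> = {}" | b where "sphere a \<rho> = {b}"
    using connected_finite_iff_sing by blast
  moreover have "a + \<rho> *\<^sub>R axis 1 1 \<in> sphere a \<rho>" "a - \<rho> *\<^sub>R axis 1 1 \<in> sphere a \<rho>"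
    using assms by (simp_all add: dist_norm)
  moreover have "a + \<rho> *\<^sub>R axis 1 1 \<noteq> a - \<rho> *\<^sub>R axis 1 1"
  proof
    assume "a + \<rho> *\<^sub>R axis 1 1 = a - \<rho> *\<^sub>R axis 1 1"
    from arg_cong[OF this, of "\<lambda>x. x $ 1"] have "a $ 1 + \<rho> = a $ 1 - \<rho>"
      by (simp only: vector_add_component vector_minus_component vector_scaleR_component
          axis_nth real_scaleR_def mult_1_right)
    then show False using assms by simp
  qed
  ultimately show False by (metis empty_iff singleton_iff)
qed

lemma dist_plane: "dist x y = sqrt ((x $ 1 - y $ 1)\<^sup>2 + (x $ 2 - y $ 2)\<^sup>2)"
  for x y :: "real ^ 2"
  by (simp add: dist_vec_def L2_set_def sum_2 dist_real_def)

text \<open>Chords from \<open>x\<close> to other common points are perpendicular to the line of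
  centres. Their length along that normal solves a quadratic equation with root 0, which leaves one
  nonzero value.\<close>

lemma circles_meet_at_most_twice:
  fixes a b x y z :: "real ^ 2"
  assumes ab: "a \<noteq> b"
    and a: "dist x a = s" "dist y a = s" "dist z a = s"
    and b: "dist x b = t" "dist y b = t" "dist z b = t"
  shows "x = y \<or> y = z \<or> x = z"
proof (rule ccontr)
  assume neg: "\<not> ?thesis"
  define d1 d2 where "d1 = b $ 1 - a $ 1" and "d2 = b $ 2 - a $ 2"
  define y1 y2 z1 z2 where "y1 = y $ 1 - x $ 1" and "y2 = y $ 2 - x $ 2"
    and "z1 = z $ 1 - x $ 1" and "z2 = z $ 2 - x $ 2"
  define p q where "p = x $ 1 - a $ 1" and "q = x $ 2 - a $ 2"
  note defs = d1_def d2_def y1_def y2_def z1_def z2_def p_def q_def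
  have d: "d1\<^sup>2 + d2\<^sup>2 > 0"
    using ab by (auto simp: vec_eq_iff forall_2 d1_def d2_def sum_power2_gt_zero_iff)
  have sq: "(u $ 1 - c $ 1)\<^sup>2 + (u $ 2 - c $ 2)\<^sup>2 = (v $ 1 - c $ 1)\<^sup>2 + (v $ 2 - c $ 2)\<^sup>2"
    if "dist u c = m" "dist v c = m" for u v c :: "real^2" and m
    using that by (auto simp: dist_plane)
  have Y: "y1\<^sup>2 + y2\<^sup>2 + 2 * (y1 * p + y2 * q) = 0"
    using sq[OF a(1,2)] unfolding defs by algebra
  have Z: "z1\<^sup>2 + z2\<^sup>2 + 2 * (z1 * p + z2 * q) = 0"
    using sq[OF a(1,3)] unfolding defs by algebra
  \<comment> \<open>Subtracting the equations for the two centres cancels the quadratic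
    terms.\<close>
  have Yd: "y1 * d1 + y2 * d2 = 0"
    using sq[OF a(1,2)] sq[OF b(1,2)] unfolding defs by algebra
  have Zd: "z1 * d1 + z2 * d2 = 0"
    using sq[OF a(1,3)] sq[OF b(1,3)] unfolding defs by algebra
  \<comment> \<open>\<open>\<beta>\<close>, \<open>\<gamma>\<close> and \<open>\<kappa>\<close> are
    the cross products of \<open>b - a\<close> with \<open>y - x\<close>, \<open>z - x\<close> and
    \<open>x - a\<close>.\<close>
  define D \<beta> \<gamma> \<kappa> where "D = d1\<^sup>2 + d2\<^sup>2" and "\<beta> = y2 * d1 - y1 * d2"
    and "\<gamma> = z2 * d1 - z1 * d2" and "\<kappa> = q * d1 - p * d2"
  have y: "D * y1 = - (\<beta> * d2)" "D * y2 = \<beta> * d1"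
    and z: "D * z1 = - (\<gamma> * d2)" "D * z2 = \<gamma> * d1"
    using Yd Zd unfolding D_def \<beta>_def \<gamma>_def by algebra+
  \<comment> \<open>This is \<open>D\<close> times \<open>Y\<close>, rewritten by Lagrange's
    identity with the vanishing scalar product \<open>Yd\<close>.\<close>
  have "\<beta> * (\<beta> + 2 * \<kappa>) = 0"
    using Y Yd unfolding \<beta>_def \<kappa>_def by algebra
  moreover have "\<gamma> * (\<gamma> + 2 * \<kappa>) = 0"
    using Z Zd unfolding \<gamma>_def \<kappa>_def by algebra
  moreover have "D \<noteq> 0" using d unfolding D_def by linarith
  moreover have "\<beta> \<noteq> 0"
  proof
    assume "\<beta> = 0"
    then have "y1 = 0" "y2 = 0" using y \<open>D \<noteq> 0\<close> by auto
    then show False using neg by (auto simp: vec_eq_iff forall_2 defs)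
  qed
  moreover have "\<gamma> \<noteq> 0"
  proof
    assume "\<gamma> = 0"
    then have "z1 = 0" "z2 = 0" using z \<open>D \<noteq> 0\<close> by auto
    then show False using neg by (auto simp: vec_eq_iff forall_2 defs)
  qed
  ultimately have "\<beta> = \<gamma>" by simp
  then have "D * y1 = D * z1" "D * y2 = D * z2" using y z by simp_all
  then have "y1 = z1" "y2 = z2" using \<open>D \<noteq> 0\<close> by auto
  then show False using neg by (auto simp: vec_eq_iff forall_2 defs)
qed

section \<open>Paths, counting and choice of disjoint sets\<close>

text \<open>When a step returns to a visited point, the path is cut back to the prefix ending there.
  The bound on \<open>set xs\<close> serves to show that a path avoids a given vertex.\<close>

lemma rtrancl_distinct_path:
  assumes "(a, b) \<in> R\<^sup>*"
  shows "\<exists>xs. distinct xs \<and> xs \<noteq> [] \<and> hd xs = a \<and> last xs = b \<and>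
           (\<forall>i. Suc i < length xs \<longrightarrow> (xs ! i, xs ! Suc i) \<in> R) \<and> set xs \<subseteq> insert a (Range R)"
  using assms
proof (induction rule: rtrancl_induct)
  case base
  show ?case by (rule exI[of _ "[a]"]) simp
next
  case (step b c)
  then obtain xs where xs: "distinct xs" "xs \<noteq> []" "hd xs = a" "last xs = b"
    "\<And>i. Suc i < length xs \<Longrightarrow> (xs ! i, xs ! Suc i) \<in> R" "set xs \<subseteq> insert a (Range R)" by blast
  show ?case
  proof (cases "c \<in> set xs")
    case True
    then obtain ys zs where "xs = (ys @ [c]) @ zs"
      by (metis append.assoc append_Cons append_Nil split_list)
    moreover have "(ys @ [c]) ! i = xs ! i" if "i < length (ys @ [c])" for i
      using that calculation by (simp only: nth_append_left)
    ultimately show ?thesis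
      using xs by (intro exI[of _ "ys @ [c]"]) (auto simp: hd_append)
  next
    case False
    have "((xs @ [c]) ! i, (xs @ [c]) ! Suc i) \<in> R" if "Suc i < length (xs @ [c])" for i
    proof (cases "Suc i < length xs")
      case True
      then show ?thesis using xs(5) by (simp add: nth_append)
    next
      case False
      then have "i = length xs - 1" using that by simp
      then show ?thesis using xs(2,4) step.hyps(2) by (simp add: nth_append last_conv_nth)
    qed
    then show ?thesis
      using xs step.hyps False by (intro exI[of _ "xs @ [c]"]) auto
  qed
qed

lemma card_le_2:
  assumes "\<And>x y z. x \<in> A \<Longrightarrow> y \<in> A \<Longrightarrow> z \<in> A \<Longrightarrow> x = y \<or> y = z \<or> x = z"
  shows "card A \<le> 2"
proof (rule ccontr)
  assume "\<not> card A \<le> 2"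
  then have "3 \<le> card A" by simp
  then obtain B where "B \<subseteq> A" "card B = 3" by (rule obtain_subset_with_card_n)
  then obtain x y z where "{x, y, z} \<subseteq> A" "x \<noteq> y" "y \<noteq> z" "x \<noteq> z"
    by (auto simp: card_3_iff)
  then show False using assms[of x y z] by blast
qed

text \<open>A restriction to \<open>insert x S\<close> is determined by the one to \<open>S\<close>
  and the value at \<open>x\<close>, and each fibre over the former has at most \<open>k\<close>
  such values. This counts maps one vertex at a time.\<close>

lemma card_restrict_insert_le:
  assumes "finite F"
    and "\<And>f. f \<in> F \<Longrightarrow> card {g x | g. g \<in> F \<and> restrict g S = restrict f S} \<le> k"
  shows "card ((\<lambda>f. restrict f (insert x S)) ` F) \<le> k * card ((\<lambda>f. restrict f S) ` F)"
proof -
  let ?G = "(\<lambda>f. restrict f S) ` F"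
  let ?X = "\<lambda>g. {f x | f. f \<in> F \<and> restrict f S = g}"
  have fin: "finite (?X g)" for g
    by (rule finite_subset[of _ "(\<lambda>f. f x) ` F"]) (use assms(1) in auto)
  have "(\<lambda>f. restrict f (insert x S)) ` F \<subseteq> (\<Union>g\<in>?G. (\<lambda>p. g(x := p)) ` ?X g)"
  proof clarify
    fix f assume "f \<in> F"
    moreover have "restrict f (insert x S) = (restrict f S)(x := f x)" by auto
    ultimately show "restrict f (insert x S) \<in> (\<Union>g\<in>?G. (\<lambda>p. g(x := p)) ` ?X g)"
      by blast
  qed
  then have "card ((\<lambda>f. restrict f (insert x S)) ` F) \<le> card (\<Union>g\<in>?G. (\<lambda>p. g(x := p)) ` ?X g)"
    using assms(1) fin by (intro card_mono) auto
  also have "\<dots> \<le> (\<Sum>g\<in>?G. card ((\<lambda>p. g(x := p)) ` ?X g))"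
    using assms(1) by (intro card_UN_le) simp
  also have "\<dots> \<le> (\<Sum>g\<in>?G. k)"
  proof (rule sum_mono)
    fix g assume "g \<in> ?G"
    then have "card (?X g) \<le> k" using assms(2) by blast
    then show "card ((\<lambda>p. g(x := p)) ` ?X g) \<le> k"
      using card_image_le[OF fin] le_trans by blast
  qed
  finally show ?thesis by (simp add: mult.commute)
qed

text \<open>Greedy choice: removing the finitely many points already taken leaves each
  \<open>S i\<close> infinite.\<close>

lemma ex_disjoint_finite_subfamily:
  assumes "finite I" "\<And>i. i \<in> I \<Longrightarrow> infinite (S i)"
  shows "\<exists>A. (\<forall>i\<in>I. finite (A i) \<and> card (A i) = k \<and> A i \<subseteq> S i) \<and> disjoint_family_on A I"
  using assms
proof (induction rule: finite_induct)
  case empty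
  show ?case by (simp add: disjoint_family_on_def)
next
  case (insert x I)
  then obtain A where A: "\<forall>i\<in>I. finite (A i) \<and> card (A i) = k \<and> A i \<subseteq> S i"
    "disjoint_family_on A I" by auto
  have "infinite (S x - (\<Union>i\<in>I. A i))"
    using insert.hyps insert.prems A by (intro Diff_infinite_finite) auto
  then obtain B where "finite B" "card B = k" "B \<subseteq> S x - (\<Union>i\<in>I. A i)"
    using infinite_arbitrarily_large by blast
  then show ?case
    using A insert.hyps
    by (intro exI[of _ "A(x := B)"]) (auto simp: disjoint_family_on_def)
qed

section \<open>Depth, parents and children in a rooted tree\<close>

locale rooted_tree =
  fixes V :: "'v set" and E :: "'v set set" and r :: 'v
  assumes tree: "is_tree V E" and root: "r \<in> V"
begin

abbreviation depth :: "'v \<Rightarrow> nat" where "depth \<equiv> graph_dist E r"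

lemma finite_V: "finite V"
  using tree by (simp add: is_tree_def simple_graph_def)

lemma edgeD:
  assumes "{u, v} \<in> E"
  shows "u \<in> V" "v \<in> V" "u \<noteq> v"
  using assms tree by (auto simp: is_tree_def simple_graph_def doubleton_eq_iff)

text \<open>Connectedness rules out the junk value of \<open>graph_dist\<close>.\<close>

lemma relpow_depth: "v \<in> V \<Longrightarrow> (r, v) \<in> adj E ^^ depth v"
  unfolding graph_dist_def
  by (rule LeastI_ex, rule rtrancl_imp_relpow)
    (use tree root in \<open>simp add: is_tree_def graph_connected_def\<close>)

lemma depth_le: "(r, v) \<in> adj E ^^ k \<Longrightarrow> depth v \<le> k"
  unfolding graph_dist_def by (rule Least_le)

lemma depth_edge_le:
  assumes "{u, v} \<in> E"
  shows "depth v \<le> Suc (depth u)"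
proof -
  have "(r, v) \<in> adj E ^^ Suc (depth u)"
    using relpow_depth[of u] edgeD[OF assms] assms by (auto simp: adj_def)
  then show ?thesis by (rule depth_le)
qed

text \<open>The last vertex but one of a shortest walk from the root is such a
  \<open>u\<close>.\<close>

lemma ex_parent:
  assumes "v \<in> V" "v \<noteq> r"
  shows "\<exists>u. {u, v} \<in> E \<and> depth v = Suc (depth u)"
proof -
  have *: "(r, v) \<in> adj E ^^ depth v" using relpow_depth assms by blast
  with assms obtain k where k: "depth v = Suc k" by (cases "depth v") auto
  with * obtain u where u: "(r, u) \<in> adj E ^^ k" "(u, v) \<in> adj E" by auto
  then have "{u, v} \<in> E" by (simp add: adj_def)
  moreover have "depth u \<le> k" using u depth_le by blast
  ultimately show ?thesis using depth_edge_le k by (metis le_antisym Suc_le_mono)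
qed

text \<open>Climb from \<open>v\<close> to the root along vertices of strictly decreasing depth:
  after \<open>v\<close> all of them are less deep than \<open>x\<close>, so \<open>x\<close> is
  never met.\<close>

lemma path_to_root_avoiding:
  assumes "v \<in> V" "v \<noteq> x" "depth v \<le> depth x"
  shows "(v, r) \<in> (Restr (adj E) (- {x}))\<^sup>*"
  using assms
proof (induction "depth v" arbitrary: v rule: less_induct)
  case less
  show ?case
  proof (cases "v = r")
    case False
    then obtain u where u: "{u, v} \<in> E" "depth v = Suc (depth u)"
      using ex_parent less.prems by blast
    then have "u \<noteq> x" using less.prems by auto
    moreover have "(u, r) \<in> (Restr (adj E) (- {x}))\<^sup>*"
      using less u edgeD[OF u(1)] \<open>u \<noteq> x\<close> by simp
    moreover have "{v, u} \<in> E" using u by (simp add: insert_commute)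
    ultimately show ?thesis using less.prems
      by (intro converse_rtrancl_into_rtrancl[of v u]) (auto simp: adj_def)
  qed simp
qed

text \<open>Two such neighbours would be joined through the root by a path avoiding \<open>x\<close>, which
  closes up to a cycle.\<close>

lemma unique_lower_neighbour:
  assumes u: "{u, x} \<in> E" "depth u \<le> depth x" and v: "{v, x} \<in> E" "depth v \<le> depth x"
  shows "u = v"
proof (rule ccontr)
  assume "u \<noteq> v"
  let ?R = "Restr (adj E) (- {x})"
  have "sym ?R" by (auto simp: sym_def adj_def insert_commute)
  then have "(u, v) \<in> ?R\<^sup>*"
    using path_to_root_avoiding[of u x] path_to_root_avoiding[of v x] u v edgeD[OF u(1)] edgeD[OF v(1)]
    by (meson rtrancl_trans symD sym_rtrancl)
  from rtrancl_distinct_path[OF this] obtain xs where xs: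
    "distinct xs" "xs \<noteq> []" "hd xs = u" "last xs = v"
    "\<And>i. Suc i < length xs \<Longrightarrow> (xs ! i, xs ! Suc i) \<in> ?R" "set xs \<subseteq> insert u (Range ?R)"
    by blast
  have "x \<notin> set xs" using xs(6) edgeD[OF u(1)] by auto
  have len: "length xs \<ge> 2"
    using xs \<open>u \<noteq> v\<close> by (cases xs; cases "tl xs") auto
  have step: "{xs ! i, xs ! Suc i} \<in> E" if "Suc i < length xs" for i
    using xs(5) that by (auto simp: adj_def)
  \<comment> \<open>The edges at \<open>x\<close> close the path from \<open>u\<close> to
    \<open>v\<close>. Since \<open>u \<noteq> v\<close>, the result has at least three
    vertices.\<close>
  have "graph_cycle E (x # xs)"
    unfolding graph_cycle_def
  proof (intro conjI allI impI)
    fix i assume i: "i < length (x # xs)"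
    \<comment> \<open>The edge from \<open>x\<close> to \<open>u\<close>, the edges of the path, and
      the closing edge from \<open>v\<close> to \<open>x\<close>, where the index wraps
      around.\<close>
    consider "i = 0" | j where "i = Suc j" "Suc j < length xs" | "i = length xs"
      using i by (cases i) (auto, linarith)
    then show "{(x # xs) ! i, (x # xs) ! (Suc i mod length (x # xs))} \<in> E"
    proof cases
      case 1
      then show ?thesis using xs u by (simp add: hd_conv_nth insert_commute)
    next
      case 2
      then show ?thesis using step by simp
    next
      case 3
      then show ?thesis using xs v len by (simp add: last_conv_nth nth_Cons')
    qed
  qed (use len xs \<open>x \<notin> set xs\<close> in auto)
  then show False using tree by (auto simp: is_tree_def)
qed

text \<open>Depths along an edge differ by at most one. They cannot be equal: the other endpoint and
  the parent of \<open>v\<close> would be two different neighbours of \<open>v\<close> not deeper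
  than \<open>v\<close>.\<close>

lemma edge_cases:
  assumes "{u, v} \<in> E"
  obtains "v \<in> children E r u" | "u \<in> children E r v"
proof -
  have "{v, u} \<in> E" using assms by (simp add: insert_commute)
  have "depth u \<noteq> depth v"
  proof
    assume eq: "depth u = depth v"
    show False
    proof (cases "v = r")
      case True
      then have "depth u = 0" using eq depth_le[of r 0] by simp
      then show False using relpow_depth[of u] edgeD[OF assms] True by auto
    next
      case False
      then obtain p where "{p, v} \<in> E" "depth v = Suc (depth p)"
        using ex_parent edgeD[OF assms] by blast
      then show False using unique_lower_neighbour[OF assms, of p] eq by auto
    qed
  qed
  then show ?thesis
    using that assms \<open>{v, u} \<in> E\<close> depth_edge_le[OF assms] depth_edge_le[OF \<open>{v, u} \<in> E\<close>]
    by (force simp: children_def)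
qed

lemma children_subset: "children E r u \<subseteq> V"
  unfolding children_def using edgeD(2) by blast

lemma children_inj: "v \<in> children E r u \<Longrightarrow> v \<in> children E r u' \<Longrightarrow> u = u'"
  using unique_lower_neighbour[of u v u'] by (simp add: children_def)

text \<open>Well defined on non-root vertices by \<open>children_inj\<close>; at \<open>r\<close>
  the value is arbitrary.\<close>

definition parent :: "'v \<Rightarrow> 'v" where
  "parent v = (THE u. v \<in> children E r u)"

lemma parent_eq: "v \<in> children E r u \<Longrightarrow> parent v = u"
  unfolding parent_def by (rule the_equality) (blast dest: children_inj)+

lemma child_of_parent:
  assumes "v \<in> V" "v \<noteq> r"
  shows "v \<in> children E r (parent v)"
proof -
  obtain u where "{u, v} \<in> E" "depth v = Suc (depth u)"
    using ex_parent[OF assms] by blast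
  then have "v \<in> children E r u" by (simp add: children_def)
  then show ?thesis using parent_eq by simp
qed

lemma parentD:
  assumes "v \<in> V" "v \<noteq> r"
  shows "parent v \<in> V" "depth (parent v) < depth v" "{parent v, v} \<in> E"
proof -
  have *: "{parent v, v} \<in> E" "depth v = Suc (depth (parent v))"
    using child_of_parent[OF assms] by (simp_all add: children_def)
  then show "parent v \<in> V" "depth (parent v) < depth v" "{parent v, v} \<in> E"
    using edgeD(1)[OF *(1)] by simp_all
qed

lemma child_ne_root: "v \<in> children E r u \<Longrightarrow> v \<noteq> r"
  using depth_le[of r 0] by (auto simp: children_def)

text \<open>This allows all leaves to move at once: the centre of a leaf's circle is never itself a
  moving leaf.\<close>

lemma parent_not_leaf:
  assumes "v \<in> V" "v \<noteq> r"
  shows "parent v \<in> V - leaves V E r"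
  using child_of_parent[OF assms] parentD(1)[OF assms] by (auto simp: leaves_def)

section \<open>Embeddings of the tree in the plane\<close>

definition embedding :: "('v set \<Rightarrow> real) \<Rightarrow> ('v \<Rightarrow> real ^ 2) \<Rightarrow> bool" where
  "embedding w \<phi> \<longleftrightarrow> inj_on \<phi> V \<and> (\<forall>u v. {u, v} \<in> E \<longrightarrow> dist (\<phi> u) (\<phi> v) = w {u, v})"

text \<open>Every edge joins a non-root vertex to its parent, so one check per such vertex
  suffices.\<close>

lemma embeddingI:
  assumes "inj_on \<phi> V"
    and "\<And>v. v \<in> V \<Longrightarrow> v \<noteq> r \<Longrightarrow> dist (\<phi> (parent v)) (\<phi> v) = w {parent v, v}"
  shows "embedding w \<phi>"
  unfolding embedding_def
proof (intro conjI allI impI assms(1))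
  have *: "dist (\<phi> u) (\<phi> v) = w {u, v}" if "v \<in> children E r u" for u v
    using assms(2)[of v] parent_eq[OF that] child_ne_root[OF that] children_subset that by blast
  fix u v assume "{u, v} \<in> E"
  then show "dist (\<phi> u) (\<phi> v) = w {u, v}"
    by (cases rule: edge_cases) (use *[of v u] *[of u v] in \<open>simp_all add: dist_commute insert_commute\<close>)
qed

text \<open>Induction over vertex sets closed under parents. A deepest vertex is placed last, on a
  circle around its parent, which has infinitely many points still free.\<close>

lemma ex_embedding:
  assumes pos: "\<forall>e\<in>E. w e > 0"
  shows "\<exists>\<phi>. embedding w \<phi>"
proof -
  have "\<exists>\<phi> :: 'v \<Rightarrow> real ^ 2. inj_on \<phi> S \<and>
      (\<forall>v\<in>S. v \<noteq> r \<longrightarrow> dist (\<phi> (parent v)) (\<phi> v) = w {parent v, v})"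
    if "S \<subseteq> V" "\<forall>v\<in>S. v \<noteq> r \<longrightarrow> parent v \<in> S" for S
    using that
  proof (induction "card S" arbitrary: S)
    case 0
    then show ?case using finite_subset[OF _ finite_V] by auto
  next
    case (Suc k)
    then have fin: "finite S" and "S \<noteq> {}" by (auto intro: card_ge_0_finite)
    then have "Max (depth ` S) \<in> depth ` S" by (intro Max_in) auto
    then obtain x where x: "x \<in> S" "depth x = Max (depth ` S)" by auto
    then have max: "depth v \<le> depth x" if "v \<in> S" for v
      using fin that by simp
    \<comment> \<open>Parents are less deep than their children, so the deepest vertex is nobody's
      parent: \<open>S - {x}\<close> stays closed under parents, and moving \<open>x\<close> affects
      no other edge condition.\<close>
    have ne: "parent v \<noteq> x" if "v \<in> S" "v \<noteq> r" for v
      using max[OF that(1)] parentD(2)[of v] that Suc.prems by fastforce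
    have "\<exists>\<phi> :: 'v \<Rightarrow> real ^ 2. inj_on \<phi> (S - {x}) \<and>
      (\<forall>v\<in>S - {x}. v \<noteq> r \<longrightarrow> dist (\<phi> (parent v)) (\<phi> v) = w {parent v, v})"
      using Suc x ne fin by (intro Suc.hyps(1)) auto
    then obtain \<phi> :: "'v \<Rightarrow> real ^ 2" where \<phi>: "inj_on \<phi> (S - {x})"
      "\<And>v. v \<in> S - {x} \<Longrightarrow> v \<noteq> r \<Longrightarrow> dist (\<phi> (parent v)) (\<phi> v) = w {parent v, v}"
      by blast
    \<comment> \<open>The root may be placed anywhere; radius 1 merely keeps \<open>C\<close>
      infinite.\<close>
    define C where "C = sphere (\<phi> (parent x)) (if x = r then 1 else w {parent x, x})"
    have "infinite C"
      unfolding C_def using pos parentD(3)[of x] x Suc.prems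
      by (intro infinite_sphere_plane) auto
    then have "infinite (C - \<phi> ` S)" using fin by simp
    then obtain p where p: "p \<in> C" "p \<notin> \<phi> ` S"
      by (metis DiffD1 DiffD2 ex_in_conv finite.emptyI)
    have "inj_on (\<phi>(x := p)) S"
      using \<phi>(1) p(2) by (auto simp: inj_on_def)
    moreover have "dist ((\<phi>(x := p)) (parent v)) ((\<phi>(x := p)) v) = w {parent v, v}"
      if "v \<in> S" "v \<noteq> r" for v
      using that ne[OF that] \<phi>(2)[of v] p(1) by (auto simp: C_def)
    ultimately show ?case by blast
  qed
  from this[of V] obtain \<phi> :: "'v \<Rightarrow> real ^ 2" where "inj_on \<phi> V"
      "\<forall>v\<in>V. v \<noteq> r \<longrightarrow> dist (\<phi> (parent v)) (\<phi> v) = w {parent v, v}"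
    using parentD(1) by blast
  then show ?thesis using embeddingI by blast
qed

text \<open>Extensional maps are determined by their values on \<open>V\<close>, so they can be
  counted.\<close>

definition embeddings :: "('v set \<Rightarrow> real) \<Rightarrow> (real ^ 2) set \<Rightarrow> ('v \<Rightarrow> real ^ 2) set" where
  "embeddings w P = {\<phi> \<in> V \<rightarrow>\<^sub>E P. embedding w \<phi>}"

lemma finite_embeddings: "finite P \<Longrightarrow> finite (embeddings w P)"
  unfolding embeddings_def using finite_PiE[OF finite_V, of "\<lambda>_. P"] by simp

section \<open>Upper bound for the number of embeddings\<close>

text \<open>\<open>S\<close> grows from the leaves to \<open>V\<close> by adding a deepest missing
  vertex each time. Two of its children are already placed, so each addition costs at most a factor
  2.\<close>

lemma card_embeddings_le_restrict:
  assumes "finite P"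
    and branching: "\<And>v. v \<in> V - leaves V E r \<Longrightarrow> card (children E r v) \<ge> 2"
    and "leaves V E r \<subseteq> S" "S \<subseteq> V"
  shows "card (embeddings w P) \<le> 2 ^ card (V - S) * card ((\<lambda>\<phi>. restrict \<phi> S) ` embeddings w P)"
  using assms(3,4)
proof (induction "card (V - S)" arbitrary: S)
  case 0
  then have "S = V" using finite_V by auto
  moreover have "restrict \<phi> V = \<phi>" if "\<phi> \<in> embeddings w P" for \<phi>
    using that by (auto simp: embeddings_def PiE_def extensional_restrict)
  ultimately show ?case by simp
next
  case (Suc k)
  let ?F = "embeddings w P"
  have "finite (V - S)" using finite_V by simp
  moreover have "V - S \<noteq> {}" using Suc.hyps(2) by (metis card.empty nat.distinct(1))
  ultimately have "Max (depth ` (V - S)) \<in> depth ` (V - S)" by (intro Max_in) auto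
  then obtain x where x: "x \<in> V - S" "depth x = Max (depth ` (V - S))" by auto
  \<comment> \<open>A child outside \<open>S\<close> would be a deeper missing vertex.\<close>
  have "children E r x \<subseteq> S"
  proof
    fix y assume y: "y \<in> children E r x"
    show "y \<in> S"
    proof (rule ccontr)
      assume "y \<notin> S"
      then have "y \<in> V - S" using y children_subset by blast
      then have "depth y \<le> depth x" using x(2) \<open>finite (V - S)\<close> by simp
      then show False using y by (simp add: children_def)
    qed
  qed
  moreover have "2 \<le> card (children E r x)" using branching x(1) Suc.prems(1) by blast
  then obtain B where "B \<subseteq> children E r x" "card B = 2" by (rule obtain_subset_with_card_n)
  then obtain a b where "{a, b} \<subseteq> children E r x" "a \<noteq> b" by (auto simp: card_2_iff)
  ultimately have ab: "a \<in> S" "b \<in> S" "a \<noteq> b" "{x, a} \<in> E" "{x, b} \<in> E"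
    by (auto simp: children_def)
  have two: "card {g x | g. g \<in> ?F \<and> restrict g S = restrict f S} \<le> 2" if "f \<in> ?F" for f
  proof (rule card_le_2)
    \<comment> \<open>Injectivity makes the two circles around the children have distinct
      centres.\<close>
    have fab: "f a \<noteq> f b"
      using that ab(1-3) Suc.prems(2) inj_onD[of f V a b]
      by (auto simp: embeddings_def embedding_def)
    have on_circles: "dist p (f a) = w {x, a} \<and> dist p (f b) = w {x, b}"
      if p: "p \<in> {g x | g. g \<in> ?F \<and> restrict g S = restrict f S}" for p
    proof -
      obtain g where g: "p = g x" "g \<in> ?F" "restrict g S = restrict f S" using p by blast
      have "g a = f a" "g b = f b"
        using fun_cong[OF g(3), of a] fun_cong[OF g(3), of b] ab(1,2) by simp_all
      moreover have "dist (g x) (g a) = w {x, a}" "dist (g x) (g b) = w {x, b}"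
        using g(2) ab(4,5) unfolding embeddings_def embedding_def by blast+
      ultimately show ?thesis using g(1) by simp
    qed
    show "p1 = p2 \<or> p2 = p3 \<or> p1 = p3"
      if "p1 \<in> {g x | g. g \<in> ?F \<and> restrict g S = restrict f S}"
        "p2 \<in> {g x | g. g \<in> ?F \<and> restrict g S = restrict f S}"
        "p3 \<in> {g x | g. g \<in> ?F \<and> restrict g S = restrict f S}" for p1 p2 p3
      using circles_meet_at_most_twice[OF fab] on_circles that by blast
  qed
  have ins: "card (V - S) = Suc (card (V - insert x S))"
    using x(1) \<open>finite (V - S)\<close> by (metis Diff_insert card_Suc_Diff1)
  then have "card ?F \<le> 2 ^ card (V - insert x S) * card ((\<lambda>\<phi>. restrict \<phi> (insert x S)) ` ?F)"
    using Suc x(1) by (intro Suc.hyps(1)) auto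
  also have "\<dots> \<le> 2 ^ card (V - insert x S) * (2 * card ((\<lambda>\<phi>. restrict \<phi> S) ` ?F))"
    using card_restrict_insert_le[OF finite_embeddings[OF assms(1)] two] by simp
  finally show ?case using ins by simp
qed

text \<open>Start the previous count from the leaves, whose restrictions are arbitrary maps into
  \<open>P\<close> at worst.\<close>

lemma card_embeddings_le:
  assumes "finite P"
    and "\<And>v. v \<in> V - leaves V E r \<Longrightarrow> card (children E r v) \<ge> 2"
  shows "card (embeddings w P) \<le> 2 ^ card V * card P ^ card (leaves V E r)"
proof -
  let ?L = "leaves V E r"
  have L: "?L \<subseteq> V" "finite ?L"
    using finite_V by (auto simp: leaves_def)
  have "(\<lambda>\<phi>. restrict \<phi> ?L) ` embeddings w P \<subseteq> ?L \<rightarrow>\<^sub>E P"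
    using L(1) by (auto simp: embeddings_def PiE_iff)
  then have "card ((\<lambda>\<phi>. restrict \<phi> ?L) ` embeddings w P) \<le> card (?L \<rightarrow>\<^sub>E P)"
    using L(2) assms(1) by (intro card_mono finite_PiE) auto
  also have "\<dots> = card P ^ card ?L"
    using L(2) by (simp add: card_PiE)
  finally have "2 ^ card (V - ?L) * card ((\<lambda>\<phi>. restrict \<phi> ?L) ` embeddings w P)
      \<le> 2 ^ card V * card P ^ card ?L"
    using finite_V by (intro mult_mono power_increasing card_mono) auto
  with card_embeddings_le_restrict[OF assms order_refl L(1)] show ?thesis
    by (meson le_trans)
qed

section \<open>Configurations versus embeddings\<close>

text \<open>The order of a tuple is not tied to the vertices, so one embedding may account for
  several tuples, but all of them are lists of length \<open>card V\<close> over its image.\<close>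

lemma card_configurations_le_embeddings:
  assumes "finite P"
  shows "card (configurations_in V E w P) \<le> card V ^ card V * card (embeddings w P)"
proof -
  let ?F = "embeddings w P"
  let ?X = "\<lambda>\<phi>. {X. set X \<subseteq> \<phi> ` V \<and> length X = card V}"
  have "configurations_in V E w P \<subseteq> (\<Union>\<phi>\<in>?F. ?X \<phi>)"
  proof
    fix X assume "X \<in> configurations_in V E w P"
    then obtain \<phi> where X: "set X \<subseteq> P" "length X = card V" and \<phi>: "bij_betw \<phi> V (set X)"
      "\<forall>u v. {u, v} \<in> E \<longrightarrow> dist (\<phi> u) (\<phi> v) = w {u, v}"
      unfolding configurations_in_def distance_configuration_def by blast
    have "embedding w (restrict \<phi> V)"
      unfolding embedding_def
      using bij_betw_imp_inj_on[OF \<phi>(1)] \<phi>(2) edgeD(1,2) by (simp add: inj_on_restrict_eq)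
    moreover have "\<phi> ` V = set X" using \<phi>(1) by (rule bij_betw_imp_surj_on)
    ultimately have "restrict \<phi> V \<in> ?F" "X \<in> ?X (restrict \<phi> V)"
      using X by (auto simp: embeddings_def)
    then show "X \<in> (\<Union>\<phi>\<in>?F. ?X \<phi>)" by blast
  qed
  then have "card (configurations_in V E w P) \<le> card (\<Union>\<phi>\<in>?F. ?X \<phi>)"
    using finite_V finite_embeddings[OF assms]
    by (intro card_mono finite_UN_I finite_lists_length_eq) auto
  also have "\<dots> \<le> (\<Sum>\<phi>\<in>?F. card (?X \<phi>))"
    by (rule card_UN_le[OF finite_embeddings[OF assms]])
  also have "\<dots> \<le> (\<Sum>\<phi>\<in>?F. card V ^ card V)"
    using finite_V by (intro sum_mono) (simp add: card_lists_length_eq card_image_le power_mono)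
  finally show ?thesis by (simp add: mult.commute)
qed

text \<open>Listing the values along a fixed enumeration of \<open>V\<close> turns different
  embeddings into different tuples.\<close>

lemma card_embeddings_le_configurations:
  assumes "finite P"
  shows "card (embeddings w P) \<le> card (configurations_in V E w P)"
proof -
  obtain vs where vs: "set vs = V" "distinct vs"
    using finite_distinct_list[OF finite_V] by blast
  show ?thesis
  proof (rule card_inj_on_le[of "\<lambda>\<phi>. map \<phi> vs"])
    show "inj_on (\<lambda>\<phi>. map \<phi> vs) (embeddings w P)"
    proof (rule inj_onI)
      fix \<phi> \<psi> assume "\<phi> \<in> embeddings w P" "\<psi> \<in> embeddings w P" "map \<phi> vs = map \<psi> vs"
      then show "\<phi> = \<psi>"
        using vs(1) by (intro PiE_ext[of _ V "\<lambda>_. P"]) (auto simp: embeddings_def)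
    qed
    show "(\<lambda>\<phi>. map \<phi> vs) ` embeddings w P \<subseteq> configurations_in V E w P"
    proof (rule image_subsetI)
      fix \<phi> assume "\<phi> \<in> embeddings w P"
      then have "bij_betw \<phi> V (set (map \<phi> vs))" "set (map \<phi> vs) \<subseteq> P"
        "\<forall>u v. {u, v} \<in> E \<longrightarrow> dist (\<phi> u) (\<phi> v) = w {u, v}"
        using vs(1) by (auto simp: embeddings_def embedding_def bij_betw_def)
      then show "map \<phi> vs \<in> configurations_in V E w P"
        using vs distinct_card[OF vs(2)]
        unfolding configurations_in_def distance_configuration_def by auto
    qed
    show "finite (configurations_in V E w P)"
      using assms by (rule finite_configurations_in)
  qed
qed

section \<open>Lower bound for the number of embeddings\<close>

text \<open>Inner vertices keep their places in one embedding, and each leaf gets \<open>k\<close>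
  places on its circle. These sets are disjoint from each other and from the old image, so all
  combinations are injective.\<close>

lemma ex_many_embeddings:
  assumes pos: "\<forall>e\<in>E. w e > 0"
    and n: "card V + k * card (leaves V E r) \<le> n"
  shows "\<exists>P. finite P \<and> card P = n \<and> k ^ card (leaves V E r) \<le> card (embeddings w P)"
proof -
  let ?L = "leaves V E r"
  have L: "?L \<subseteq> V" "finite ?L"
    using finite_V by (auto simp: leaves_def)
  obtain \<phi> where \<phi>: "embedding w \<phi>" using ex_embedding[OF pos] by blast
  \<comment> \<open>If the root is a leaf, it is unconstrained and any infinite set would
    do.\<close>
  define C where "C v = sphere (\<phi> (parent v)) (if v = r then 1 else w {parent v, v})" for v
  have "infinite (C v - \<phi> ` V)" if "v \<in> ?L" for v
  proof -
    have "v = r \<or> {parent v, v} \<in> E" using that L(1) parentD(3) by blast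
    then have "infinite (C v)"
      unfolding C_def using pos by (intro infinite_sphere_plane) auto
    then show ?thesis using finite_V by simp
  qed
  from ex_disjoint_finite_subfamily[OF L(2) this, of "\<lambda>v. v" k]
  obtain A where A: "\<And>v. v \<in> ?L \<Longrightarrow> finite (A v) \<and> card (A v) = k \<and> A v \<subseteq> C v - \<phi> ` V"
    and disj: "disjoint_family_on A ?L" by blast
  define Q where "Q = \<phi> ` (V - ?L) \<union> (\<Union>v\<in>?L. A v)"
  have "finite Q" unfolding Q_def using A L finite_V by auto
  have "card (\<Union>v\<in>?L. A v) \<le> (\<Sum>v\<in>?L. card (A v))" by (rule card_UN_le[OF L(2)])
  also have "\<dots> = k * card ?L" using A by simp
  finally have "card (\<Union>v\<in>?L. A v) \<le> k * card ?L" .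
  moreover have "card (\<phi> ` (V - ?L)) \<le> card V"
    using finite_V by (meson Diff_subset card_image_le card_mono finite_Diff le_trans)
  ultimately have "card Q \<le> n"
    unfolding Q_def using n card_Un_le[of "\<phi> ` (V - ?L)" "\<Union>v\<in>?L. A v"] by linarith
  have "infinite (- Q)"
  proof
    assume "finite (- Q)"
    then have "finite (UNIV :: (real ^ 2) set)"
      using \<open>finite Q\<close> by (metis Compl_partition finite_UnI)
    then show False using finite_imp_bounded not_bounded_UNIV by blast
  qed
  \<comment> \<open>Arbitrary extra points pad \<open>Q\<close> to exactly \<open>n\<close>
    points.\<close>
  then obtain B where B: "finite B" "card B = n - card Q" "B \<subseteq> - Q"
    using infinite_arbitrarily_large by blast
  define P where "P = Q \<union> B"
  have P: "finite P" "card P = n" "Q \<subseteq> P"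
    using B \<open>finite Q\<close> \<open>card Q \<le> n\<close>
    by (auto simp: P_def card_Un_disjoint disjoint_eq_subset_Compl Int_commute)
  define glue where "glue \<tau> = restrict (\<lambda>v. if v \<in> ?L then \<tau> v else \<phi> v) V" for \<tau>
  have "card (PiE ?L A) \<le> card (embeddings w P)"
  proof (rule card_inj_on_le[of glue])
    show "inj_on glue (PiE ?L A)"
    proof (rule inj_onI)
      fix \<tau> \<psi> assume *: "\<tau> \<in> PiE ?L A" "\<psi> \<in> PiE ?L A" "glue \<tau> = glue \<psi>"
      have "\<tau> v = \<psi> v" if "v \<in> ?L" for v
        using fun_cong[OF *(3), of v] that L(1) by (auto simp: glue_def)
      then show "\<tau> = \<psi>" by (rule PiE_ext[OF *(1,2)])
    qed
    show "glue ` PiE ?L A \<subseteq> embeddings w P"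
    proof (rule image_subsetI)
      fix \<tau> assume "\<tau> \<in> PiE ?L A"
      then have leaf: "glue \<tau> v \<in> A v" if "v \<in> ?L" for v
        using that L(1) by (auto simp: glue_def)
      have inner: "glue \<tau> v = \<phi> v" if "v \<in> V - ?L" for v
        using that by (simp add: glue_def)
      have "glue \<tau> v \<in> Q" if "v \<in> V" for v
        using that leaf[of v] inner[of v] unfolding Q_def by (cases "v \<in> ?L") auto
      then have "glue \<tau> \<in> V \<rightarrow>\<^sub>E P"
        using P(3) by (auto simp: glue_def)
      moreover have "embedding w (glue \<tau>)"
      proof (rule embeddingI)
        \<comment> \<open>The new leaf positions were chosen outside the image of \<open>V\<close>
          under \<open>\<phi>\<close>.\<close>
        have mixed: "glue \<tau> u \<noteq> glue \<tau> v" if "u \<in> ?L" "v \<in> V - ?L" for u v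
          using leaf[OF that(1)] A[OF that(1)] inner[OF that(2)] that(2) by auto
        show "inj_on (glue \<tau>) V"
        proof (rule inj_onI)
          fix u v assume uv: "u \<in> V" "v \<in> V" "glue \<tau> u = glue \<tau> v"
          consider "u \<in> ?L" "v \<in> ?L" | "u \<in> V - ?L" "v \<in> V - ?L"
            using mixed[of u v] mixed[of v u] uv by auto
          then show "u = v"
          proof cases
            case 1
            then show ?thesis
              using leaf[of u] leaf[of v] uv(3) disj by (auto simp: disjoint_family_on_def)
          next
            case 2
            then show ?thesis
              using inner uv \<phi> by (auto simp: embedding_def inj_on_def)
          qed
        qed
        fix v assume v: "v \<in> V" "v \<noteq> r"
        have p: "glue \<tau> (parent v) = \<phi> (parent v)"
          using inner parent_not_leaf[OF v] by blast
        show "dist (glue \<tau> (parent v)) (glue \<tau> v) = w {parent v, v}"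
        proof (cases "v \<in> ?L")
          case True
          then have "glue \<tau> v \<in> C v" using leaf A by blast
          then show ?thesis using p v(2) by (simp add: C_def)
        next
          case False
          then show ?thesis
            using p inner[of v] v \<phi> parentD(3)[OF v] by (simp add: embedding_def)
        qed
      qed
      ultimately show "glue \<tau> \<in> embeddings w P" by (simp add: embeddings_def)
    qed
    show "finite (embeddings w P)" using P(1) by (rule finite_embeddings)
  qed
  moreover have "card (PiE ?L A) = k ^ card ?L"
    using A L(2) by (simp add: card_PiE)
  ultimately show ?thesis using P by auto
qed

section \<open>Bounds for the maximum and the order of growth\<close>

lemma max_configurations_le:
  assumes "\<And>v. v \<in> V - leaves V E r \<Longrightarrow> card (children E r v) \<ge> 2"
  shows "max_configurations V E w n \<le> card V ^ card V * 2 ^ card V * n ^ card (leaves V E r)"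
  unfolding max_configurations_def
proof (subst Max_le_iff[OF max_configurations_range], clarify)
  fix P :: "(real ^ 2) set" assume "finite P" "n = card P"
  have "card (configurations_in V E w P) \<le> card V ^ card V * card (embeddings w P)"
    by (rule card_configurations_le_embeddings[OF \<open>finite P\<close>])
  also have "\<dots> \<le> card V ^ card V * (2 ^ card V * card P ^ card (leaves V E r))"
    using card_embeddings_le[OF \<open>finite P\<close> assms] by (intro mult_left_mono) auto
  finally show "card (configurations_in V E w P)
      \<le> card V ^ card V * 2 ^ card V * card P ^ card (leaves V E r)"
    by (simp add: mult.assoc)
qed

lemma max_configurations_ge:
  assumes "\<forall>e\<in>E. w e > 0" "card V + k * card (leaves V E r) \<le> n"
  shows "k ^ card (leaves V E r) \<le> max_configurations V E w n"
proof -
  obtain P where P: "finite P" "card P = n" "k ^ card (leaves V E r) \<le> card (embeddings w P)"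
    using ex_many_embeddings[OF assms] by blast
  have "k ^ card (leaves V E r) \<le> card (configurations_in V E w P)"
    using P(3) card_embeddings_le_configurations[OF P(1)] by (rule le_trans)
  also have "\<dots> \<le> max_configurations V E w n"
    unfolding max_configurations_def using P(1,2)
    by (intro Max_ge max_configurations_range(1)) blast
  finally show ?thesis .
qed

end

theorem mainTheorem3:
  fixes c h :: nat
    and V :: "'v set" and E :: "'v set set" and r :: 'v
    and w :: "'v set \<Rightarrow> real"
  assumes "c \<ge> 2" and "h \<ge> 0"
    and "perfect_tree c h V E r"
    and "\<forall>e\<in>E. w e > 0"
  shows "same_order (\<lambda>n. real (max_configurations V E w n)) (\<lambda>n. real n ^ (c ^ h))"
proof -
  interpret rooted_tree V E r
    using assms(3) by unfold_locales (simp_all add: perfect_tree_def)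
  have leaves: "card (leaves V E r) = c ^ h"
    and "\<And>v. v \<in> V - leaves V E r \<Longrightarrow> card (children E r v) = c"
    using assms(3) by (simp_all add: perfect_tree_def)
  then have branching: "\<And>v. v \<in> V - leaves V E r \<Longrightarrow> card (children E r v) \<ge> 2"
    using assms(1) by simp
  define m q where "m = card V" and "q = c ^ h"
  have "q > 0" using assms(1) by (simp add: q_def)
  \<comment> \<open>The first summand serves the upper bound, the second the lower bound.\<close>
  define C where "C = m ^ m * 2 ^ m + (2 * q) ^ q"
  have "max_configurations V E w n \<le> C * n ^ q \<and> n ^ q \<le> C * max_configurations V E w n"
    if n: "n > 2 * (m + q)" for n
  proof
    have "max_configurations V E w n \<le> m ^ m * 2 ^ m * n ^ q"
      using max_configurations_le[OF branching] leaves by (simp add: m_def q_def)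
    also have "\<dots> \<le> C * n ^ q" by (simp add: C_def)
    finally show "max_configurations V E w n \<le> C * n ^ q" .
  next
    \<comment> \<open>The largest \<open>k\<close> with \<open>m + k * q \<le> n\<close>. As
      \<open>m + q\<close> is less than half of \<open>n\<close>, the product \<open>k * q\<close>
      is at least half of \<open>n\<close>.\<close>
    define k where "k = (n - m) div q"
    have "k * q \<le> n - m" "n - m < k * q + q"
      using div_mod_decomp[of "n - m" q] mod_less_divisor[OF \<open>q > 0\<close>, of "n - m"]
      unfolding k_def by linarith+
    then have kq: "m + k * q \<le> n" "n \<le> 2 * (k * q)"
      using n by arith+
    have "n ^ q \<le> (2 * (k * q)) ^ q" using kq(2) by (rule power_mono) simp
    also have "\<dots> = (2 * q) ^ q * k ^ q" by (simp add: power_mult_distrib)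
    also have "\<dots> \<le> C * max_configurations V E w n"
      using max_configurations_ge[OF assms(4), of k n] kq(1) leaves
      by (intro mult_mono) (simp_all add: C_def m_def q_def)
    finally show "n ^ q \<le> C * max_configurations V E w n" .
  qed
  then have "\<forall>n>2 * (m + q). real (max_configurations V E w n) \<le> real C * real n ^ q
      \<and> real n ^ q \<le> real C * real (max_configurations V E w n)"
    by (metis of_nat_le_iff of_nat_mult of_nat_power)
  moreover have "C > 0" using \<open>q > 0\<close> by (simp add: C_def)
  then have "real C > 0" by simp
  ultimately show ?thesis
    unfolding same_order_def q_def by blast
qed

end
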